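(* Let $m\ge 2$, $N\ge 1$, and let $O_1,\dots,O_N$ be obstacles on the torus $\mathbb{T}^m=\mathbb{R}^m/\mathbb{Z}^m$ satisfying the standing assumptions listed in the context. Then the admissible rotation set $AR$ is a proper subset of the general rotation set $R$, i.e. $AR\subsetneq R$.
   Context: Setting. $m\ge 2$, $\mathbb{T}^m=\mathbb{R}^m/\mathbb{Z}^m$, $\phi:\mathbb{R}^m\to\mathbb{T}^m$ is the natural covering, $S_0=[0,1]^m$. The obstacles $O_1,\dots,O_N\subset\mathbb{T}^m$ are pairwise disjoint strictly convex bodies (compact, with nonempty interior) with $C^2$ boundary and diameter less than $\frac{\sqrt2}{4}$. Coordinates are chosen so that $O_{(\mathbf 0,r)}:=\phi^{-1}(O_r)\cap[0,1]^m$ is a copy of $O_r$ contained in the interior of $[0,1]^m$ for each $r$. For $\mathbf k\in\mathbb{Z}^m$ put $O_{(\mathbf k,r)}=O_{(\mathbf 0,r)}+\mathbf k$; these sets are called obstacles in $\mathbb{R}^m$. Standing assumptions: (a) for every coordinate projection $\pi_i(x_1,\dots,x_m)=x_i$ and all $r\ne r'$, $\pi_i(O_{(\mathbf 0,r)})\cap\pi_i(O_{(\mathbf 0,r')})=\emptyset$; (b) no-eclipse in $S_0$: for pairwise distinct $r,s,t$, the convex hull of $O_{(\mathbf 0,r)}\cup O_{(\mathbf 0,s)}$ is disjoint from $O_{(\mathbf 0,t)}$. Billiard. Trajectories are considered in $\Omega=\overline{\mathbb{R}^m\setminus\bigcup_{\mathbf k,r}O_{(\mathbf k,r)}}$: straight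 motion with unit speed inside $\Omega$ and reflection at the boundary with angle of incidence equal to angle of reflection. A trajectory (piece) is of type $(\mathbf k_n,r_n)_{n=0}^p$ ($p\le\infty$) if it starts at a point of $\partial O_{(\mathbf k_0,r_0)}$ and its consecutive reflections are from $O_{(\mathbf k_n,r_n)}$, $n=1,2,\dots$; for $p<\infty$ the piece ends at a point of $\partial O_{(\mathbf k_p,r_p)}$. Between. An obstacle $O_{(\mathbf k,r)}$, different from $O_{(\mathbf i,s)}$ and $O_{(\mathbf j,t)}$, is between $O_{(\mathbf i,s)}$ and $O_{(\mathbf j,t)}$ if it has a common point with the convex hull of $O_{(\mathbf i,s)}\cup O_{(\mathbf j,t)}$. Admissible sequence. A sequence $(\mathbf k_n,r_n)_{n=0}^p$ in $\mathbb{Z}^m\times\{1,\dots,N\}$ ($p$ finite or $\infty$) is admissible if (i) $\mathbf k_0=\mathbf 0$; (ii) $(\mathbf k_{n+1},r_{n+1})\neq(\mathbf k_n,r_n)$ for every $n<p$; (iii) for every $n<p$ there is no obstacle between $O_{(\mathbf k_n,r_n)}$ and $O_{(\mathbf k_{n+1},r_{n+1})}$; (iv) for every $n<p-1$ the obstacle $O_{(\mathbf k_{n+1},r_{n+1})}$ is not between $O_{(\mathbf k_n,r_n)}$ and $O_{(\mathbf k_{n+2},r_{n+2})}$. Rotation sets. For a trajectory piece $T$ from $\mathbf x$ to $\mathbf y$ in $\mathbb{R}^m$ let $|T|$ be its length and $d(T)=\mathbf y-\mathbf x$ its displacement. The general rotation set $R$ is the set of all limit points of sequences $\left(\frac{d(T_n)}{|T_n|}\right)_{n\ge1}$,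 where the $T_n$ are trajectory pieces in $\mathbb{R}^m$ with $|T_n|\to\infty$. The admissible rotation set $AR$ is the set of all such limit points when, in addition, each $T_n$ is a trajectory piece whose type is a (finite) admissible sequence. *)

theory Defs
  imports "HOL-Analysis.Analysis"
begin

section \<open>The torus and its covering\<close>

definition int_vec :: "int ^ 'm \<Rightarrow> real ^ 'm" where
  "int_vec k = (\<chi> i. of_int (k $ i))"

text \<open>Points of the torus are cosets of the integer lattice. The map below is the natural
  covering, and its range is the torus.\<close>

definition torus_proj :: "real ^ 'm \<Rightarrow> (real ^ 'm) set" where
  "torus_proj x = range (\<lambda>k. x + int_vec k)"

definition torus :: "(real ^ 'm) set set" where
  "torus = range torus_proj"

section \<open>Strictly convex bodies with smooth boundary\<close>

definition strictly_convex_body :: "(real ^ 'm) set \<Rightarrow> bool" where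
  "strictly_convex_body S \<longleftrightarrow> compact S \<and> interior S \<noteq> {} \<and>
     (\<forall>x\<in>S. \<forall>y\<in>S. x \<noteq> y \<longrightarrow> open_segment x y \<subseteq> interior S)"

text \<open>The set is locally a sublevel set of a twice continuously differentiable function \<open>f\<close>
  (with gradient \<open>g\<close> and Hessian matrix \<open>H\<close>) of which zero is a regular value.\<close>

definition C2_boundary :: "(real ^ 'm) set \<Rightarrow> bool" where
  "C2_boundary S \<longleftrightarrow> (\<forall>p \<in> frontier S. \<exists>U f g (H :: real ^ 'm \<Rightarrow> real ^ 'm ^ 'm).
     open U \<and> p \<in> U \<and>
     (\<forall>x\<in>U. (f has_derivative (\<lambda>h. g x \<bullet> h)) (at x)) \<and>
     (\<forall>x\<in>U. (g has_derivative (\<lambda>h. H x *v h)) (at x)) \<and>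
     continuous_on U H \<and>
     (\<forall>x\<in>U. f x = (0::real) \<longrightarrow> g x \<noteq> 0) \<and>
     S \<inter> U = {x \<in> U. f x \<le> 0})"

text \<open>For a convex body with differentiable boundary the outer unit normal at a boundary point
  is the unique vector with this property.\<close>

definition outer_unit_normal :: "(real ^ 'm) set \<Rightarrow> real ^ 'm \<Rightarrow> real ^ 'm \<Rightarrow> bool" where
  "outer_unit_normal S x n \<longleftrightarrow> norm n = 1 \<and> (\<forall>y\<in>S. n \<bullet> (y - x) \<le> 0)"

section \<open>Obstacles\<close>

text \<open>The obstacles on the torus are \<open>Ob r\<close> for \<open>r \<in> {1..N}\<close>. An obstacle of the covering space is
  referred to by its index \<open>(k, r)\<close>.\<close>

type_synonym 'm obst_index = "(int ^ 'm) \<times> nat"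

definition obst_indices :: "nat \<Rightarrow> 'm obst_index set" where
  "obst_indices N = UNIV \<times> {1..N}"

definition base_obstacle :: "(nat \<Rightarrow> (real ^ 'm) set set) \<Rightarrow> nat \<Rightarrow> (real ^ 'm) set" where
  "base_obstacle Ob r = torus_proj -` Ob r \<inter> cbox 0 1"

definition obstacle :: "(nat \<Rightarrow> (real ^ 'm) set set) \<Rightarrow> 'm obst_index \<Rightarrow> (real ^ 'm) set" where
  "obstacle Ob a = (\<lambda>x. x + int_vec (fst a)) ` base_obstacle Ob (snd a)"

definition billiard_table :: "nat \<Rightarrow> (nat \<Rightarrow> (real ^ 'm) set set) \<Rightarrow> (real ^ 'm) set" where
  "billiard_table N Ob = closure (- (\<Union>a\<in>obst_indices N. obstacle Ob a))"

text \<open>Quantification of \<open>c\<close> over \<open>obst_indices N\<close> is left to the uses of this definition.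
  Comparing indices amounts to comparing obstacles when the obstacles are nonempty and disjoint.\<close>

definition between ::
  "(nat \<Rightarrow> (real ^ 'm) set set) \<Rightarrow> 'm obst_index \<Rightarrow> 'm obst_index \<Rightarrow> 'm obst_index \<Rightarrow> bool" where
  "between Ob c a b \<longleftrightarrow> c \<noteq> a \<and> c \<noteq> b \<and>
     obstacle Ob c \<inter> convex hull (obstacle Ob a \<union> obstacle Ob b) \<noteq> {}"

section \<open>Trajectory pieces\<close>

text \<open>Since the speed is one and reflections cannot accumulate in finite time (the obstacles are
  at positive mutual distance and a line segment outside a strictly convex body cannot join two of
  its points), a trajectory piece
  is given by the list of its starting point, its successive reflection points and its endpoint.
  Between these points the motion is straight and stays in the billiard table. A grazing contact,
  where the reflection law leaves the direction unchanged, may or may not be listed: this affects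
  neither length nor displacement, and for pieces of admissible type there are no such contacts
  at interior points of the piece.\<close>

definition reflection_law :: "(real ^ 'm) set \<Rightarrow> real ^ 'm \<Rightarrow> real ^ 'm \<Rightarrow> real ^ 'm \<Rightarrow> bool" where
  "reflection_law S x y z \<longleftrightarrow> y \<in> frontier S \<and> (\<exists>n. outer_unit_normal S y n \<and>
     sgn (z - y) = sgn (y - x) - (2 * (sgn (y - x) \<bullet> n)) *\<^sub>R n)"

definition trajectory_piece ::
  "nat \<Rightarrow> (nat \<Rightarrow> (real ^ 'm) set set) \<Rightarrow> (real ^ 'm) list \<Rightarrow> bool" where
  "trajectory_piece N Ob xs \<longleftrightarrow> xs \<noteq> [] \<and> set xs \<subseteq> billiard_table N Ob \<and>
     (\<forall>i. Suc i < length xs \<longrightarrow> xs ! i \<noteq> xs ! Suc i \<and>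
        closed_segment (xs ! i) (xs ! Suc i) \<subseteq> billiard_table N Ob) \<and>
     (\<forall>i. Suc (Suc i) < length xs \<longrightarrow>
        (\<exists>a\<in>obst_indices N.
           reflection_law (obstacle Ob a) (xs ! i) (xs ! Suc i) (xs ! Suc (Suc i))))"

definition piece_length :: "(real ^ 'm) list \<Rightarrow> real" where
  "piece_length xs = (\<Sum>i<length xs - 1. dist (xs ! i) (xs ! Suc i))"

definition displacement :: "(real ^ 'm) list \<Rightarrow> real ^ 'm" where
  "displacement xs = last xs - hd xs"

text \<open>A list of length \<open>p + 1\<close> stands for the sequence of obstacles with indices \<open>n = 0, \<dots>, p\<close>.
  The obstacles being disjoint, the reflection at the \<open>n\<close>-th point is from the \<open>n\<close>-th obstacle.\<close>

definition piece_of_type ::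
  "nat \<Rightarrow> (nat \<Rightarrow> (real ^ 'm) set set) \<Rightarrow> (real ^ 'm) list \<Rightarrow> 'm obst_index list \<Rightarrow> bool" where
  "piece_of_type N Ob xs as \<longleftrightarrow> trajectory_piece N Ob xs \<and>
     length as = length xs \<and> set as \<subseteq> obst_indices N \<and>
     (\<forall>n < length as. xs ! n \<in> frontier (obstacle Ob (as ! n)))"

definition admissible ::
  "nat \<Rightarrow> (nat \<Rightarrow> (real ^ 'm) set set) \<Rightarrow> 'm obst_index list \<Rightarrow> bool" where
  "admissible N Ob as \<longleftrightarrow> as \<noteq> [] \<and> set as \<subseteq> obst_indices N \<and>
     fst (as ! 0) = 0 \<and>
     (\<forall>n. Suc n < length as \<longrightarrow> as ! Suc n \<noteq> as ! n) \<and>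
     (\<forall>n. Suc n < length as \<longrightarrow>
        \<not> (\<exists>c\<in>obst_indices N. between Ob c (as ! n) (as ! Suc n))) \<and>
     (\<forall>n. Suc (Suc n) < length as \<longrightarrow>
        \<not> between Ob (as ! Suc n) (as ! n) (as ! Suc (Suc n)))"

section \<open>Rotation sets\<close>

definition limit_point_of_seq :: "(nat \<Rightarrow> 'a::topological_space) \<Rightarrow> 'a \<Rightarrow> bool" where
  "limit_point_of_seq X l \<longleftrightarrow> (\<exists>s :: nat \<Rightarrow> nat. strict_mono s \<and> (X \<circ> s) \<longlonglongrightarrow> l)"

definition rotation_set :: "nat \<Rightarrow> (nat \<Rightarrow> (real ^ 'm) set set) \<Rightarrow> (real ^ 'm) set" where
  "rotation_set N Ob = {v. \<exists>T :: nat \<Rightarrow> (real ^ 'm) list.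
     (\<forall>n. trajectory_piece N Ob (T n)) \<and>
     filterlim (\<lambda>n. piece_length (T n)) at_top sequentially \<and>
     limit_point_of_seq (\<lambda>n. displacement (T n) /\<^sub>R piece_length (T n)) v}"

definition admissible_rotation_set ::
  "nat \<Rightarrow> (nat \<Rightarrow> (real ^ 'm) set set) \<Rightarrow> (real ^ 'm) set" where
  "admissible_rotation_set N Ob = {v. \<exists>T :: nat \<Rightarrow> (real ^ 'm) list.
     (\<forall>n. \<exists>as. admissible N Ob as \<and> piece_of_type N Ob (T n) as) \<and>
     filterlim (\<lambda>n. piece_length (T n)) at_top sequentially \<and>
     limit_point_of_seq (\<lambda>n. displacement (T n) /\<^sub>R piece_length (T n)) v}"

end

theory Submission
  imports Defs
begin

text \<open>A coordinate vector \<open>axis i 1\<close> lies in the general rotation set, because the coordinate axes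
  miss all obstacles. If the flight \<open>w\<close> between two consecutive obstacles of an admissible
  sequence is almost parallel to \<open>axis i 1\<close>, then the second obstacle is the translate of the first
  one by \<open>axis i 1\<close>: a long flight would pass the translate on its way, and for a short flight the
  coordinates other than \<open>i\<close> hardly change, so that disjointness of the projections applies. Two
  consecutive flights of this kind are excluded, since the middle obstacle would be between
  the other two. Hence a positive proportion of the length of an admissible piece is spent in
  directions away from \<open>axis i 1\<close>, and \<open>axis i 1\<close> is not in the admissible rotation set.\<close>

section \<open>Uniform constants over finite sets and sums over neighbouring terms\<close>

lemma finite_uniform_pos:
  fixes P :: "real \<Rightarrow> 'a \<Rightarrow> bool"
  assumes "finite F" and "\<And>p. p \<in> F \<Longrightarrow> \<exists>d>0. P d p"
    and mono: "\<And>p d e. P d p \<Longrightarrow> e \<le> d \<Longrightarrow> P e p"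
  shows "\<exists>d>0. \<forall>p\<in>F. P d p"
  using assms(1,2)
proof (induction F rule: finite_induct)
  case empty
  show ?case by (auto intro: exI[of _ 1])
next
  case (insert q F)
  obtain d where d: "d > 0" "\<forall>p\<in>F. P d p" using insert by auto
  obtain e where e: "e > 0" "P e q" using insert.prems by blast
  have "\<forall>p\<in>insert q F. P (min d e) p"
    using d e mono[of d _ "min d e"] mono[of e q "min d e"] by auto
  then show ?case using d e by (intro exI[of _ "min d e"]) auto
qed

text \<open>An odd summand left over is accounted for by the constant \<open>K\<close>.\<close>

lemma sum_pairwise_bound:
  fixes L l :: "nat \<Rightarrow> real"
  assumes "K \<ge> 0" and "\<And>j. j < n \<Longrightarrow> c * L j - K \<le> l j"
    and "\<And>j. Suc j < n \<Longrightarrow> c * (L j + L (Suc j)) \<le> l j + l (Suc j)"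
  shows "c * sum L {..<n} - K \<le> sum l {..<n}"
  using assms(2,3)
proof (induction n rule: induct_nat_012)
  case 0
  then show ?case using assms(1) by simp
next
  case 1
  then show ?case by simp
next
  case (ge2 n)
  have "c * sum L {..<n} - K \<le> sum l {..<n}" using ge2 by simp
  moreover have "c * (L n + L (Suc n)) \<le> l n + l (Suc n)" using ge2 by simp
  ultimately show ?case by (simp add: algebra_simps)
qed

section \<open>Lattice translates of obstacles\<close>

lemma int_vec_add: "int_vec (k + l) = int_vec k + int_vec l"
  by (simp add: int_vec_def vec_eq_iff)

lemma int_vec_axis: "int_vec (axis i c) = axis i (of_int c)"
  by (simp add: int_vec_def vec_eq_iff axis_def)

lemma mem_obstacle_iff:
  "x \<in> obstacle Ob a \<longleftrightarrow> x - int_vec (fst a) \<in> base_obstacle Ob (snd a)"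
  unfolding obstacle_def by (auto simp: image_iff algebra_simps intro!: bexI[of _ "x - int_vec (fst a)"])

definition shift :: "'m \<Rightarrow> 'm obst_index \<Rightarrow> 'm::finite obst_index" where
  "shift i a = (fst a + axis i 1, snd a)"

lemma mem_obstacle_shift: "x \<in> obstacle Ob (shift i a) \<longleftrightarrow> x - axis i 1 \<in> obstacle Ob a"
  by (simp add: mem_obstacle_iff shift_def int_vec_add int_vec_axis algebra_simps)

lemma shift_neq: "shift i a \<noteq> a" "shift i (shift i a) \<noteq> a"
  by (auto simp: shift_def prod_eq_iff vec_eq_iff axis_def)

lemma shift_in_obst_indices: "a \<in> obst_indices N \<Longrightarrow> shift i a \<in> obst_indices N"
  by (auto simp: shift_def obst_indices_def)

text \<open>Expand the square. This turns a small loss \<open>norm w - w $ i\<close> into a bound on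
  the deviation of \<open>w\<close> from the multiple of \<open>axis i 1\<close> that has the same
  length.\<close>

lemma norm_diff_axis:
  fixes w :: "real ^ 'm::finite"
  shows "(norm (w - norm w *\<^sub>R axis i 1))\<^sup>2 = 2 * norm w * (norm w - w $ i)"
proof -
  have "(norm (w - norm w *\<^sub>R axis i 1))\<^sup>2 =
      w \<bullet> w - 2 * norm w * (w \<bullet> axis i 1) + norm w * norm w * (axis i (1::real) \<bullet> (axis i 1 :: real ^ 'm))"
    by (simp add: power2_norm_eq_inner inner_diff_left inner_diff_right inner_commute algebra_simps)
  also have "\<dots> = 2 * norm w * (norm w - w $ i)"
    by (simp add: inner_axis norm_eq_sqrt_inner algebra_simps)
  finally show ?thesis .
qed

text \<open>For \<open>x\<close> in the obstacle \<open>a\<close>, the point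
  \<open>x + axis i 1\<close> is the midpoint of \<open>x\<close> and its translate by twice the
  axis vector, and it lies in the middle obstacle.\<close>

lemma between_shift_shift:
  assumes "obstacle Ob a \<noteq> {}"
  shows "between Ob (shift i a) a (shift i (shift i a))"
proof -
  obtain x where x: "x \<in> obstacle Ob a" using assms by auto
  let ?C = "convex hull (obstacle Ob a \<union> obstacle Ob (shift i (shift i a)))"
  have "x \<in> ?C" "x + axis i 1 + axis i 1 \<in> ?C"
    using x by (auto intro!: hull_inc simp: mem_obstacle_shift algebra_simps)
  then have "(1/2) *\<^sub>R x + (1/2) *\<^sub>R (x + axis i 1 + axis i 1) \<in> ?C"
    by (intro convexD[OF convex_convex_hull]) auto
  also have "(1/2) *\<^sub>R x + (1/2) *\<^sub>R (x + axis i 1 + axis i 1) = x + axis i 1"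
    by (simp add: vec_eq_iff field_simps)
  finally have "x + axis i 1 \<in> ?C" .
  moreover have "x + axis i 1 \<in> obstacle Ob (shift i a)" using x by (simp add: mem_obstacle_shift)
  ultimately show ?thesis
    using shift_neq[of i a] shift_neq(1)[of i "shift i a"] by (auto simp: between_def)
qed

section \<open>Uniform separation and inner balls for the obstacles\<close>

locale obstacle_family =
  fixes N :: nat and Ob :: "nat \<Rightarrow> (real ^ 'm::finite) set set"
  assumes two_dims: "CARD('m) \<ge> 2"
    and inner: "r \<in> {1..N} \<Longrightarrow> base_obstacle Ob r \<subseteq> interior (cbox 0 1)"
    and body: "r \<in> {1..N} \<Longrightarrow> strictly_convex_body (base_obstacle Ob r)"
    and diam: "r \<in> {1..N} \<Longrightarrow> diameter (base_obstacle Ob r) \<le> 1"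
    and proj_disjoint: "\<lbrakk>r \<in> {1..N}; s \<in> {1..N}; r \<noteq> s\<rbrakk> \<Longrightarrow>
      (\<lambda>x. x $ i) ` base_obstacle Ob r \<inter> (\<lambda>x. x $ i) ` base_obstacle Ob s = {}"
begin

lemma other_coord: "\<exists>j. j \<noteq> (i :: 'm)"
  using two_dims by (metis UNIV_I card_1_singleton_iff is_singletonI' is_singleton_altdef
      numeral_le_one_iff semiring_norm(69) empty_iff)

lemma compact_base: "r \<in> {1..N} \<Longrightarrow> compact (base_obstacle Ob r)"
  using body by (simp add: strictly_convex_body_def)

lemma compact_base_proj: "r \<in> {1..N} \<Longrightarrow> compact ((\<lambda>x. x $ i) ` base_obstacle Ob r)"
  by (intro compact_continuous_image compact_base continuous_intros)

lemma base_coord: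
  assumes "r \<in> {1..N}" "x \<in> base_obstacle Ob r"
  shows "0 < x $ i" "x $ i < 1"
proof -
  have "x \<in> box 0 1" using inner assms by (auto simp: interior_cbox)
  then show "0 < x $ i" "x $ i < 1" by (auto simp: mem_box_cart)
qed

lemma norm_diff_obstacle:
  assumes "a \<in> obst_indices N" "x \<in> obstacle Ob a" "y \<in> obstacle Ob a"
  shows "norm (x - y) \<le> 1"
proof -
  have r: "snd a \<in> {1..N}" using assms(1) by (auto simp: obst_indices_def)
  have "dist (x - int_vec (fst a)) (y - int_vec (fst a)) \<le> diameter (base_obstacle Ob (snd a))"
    using assms r compact_base by (intro diameter_bounded_bound compact_imp_bounded) (auto simp: mem_obstacle_iff)
  then show ?thesis using diam[OF r] by (simp add: dist_norm)
qed

lemma obstacle_nonempty: "a \<in> obst_indices N \<Longrightarrow> obstacle Ob a \<noteq> {}"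
  using body[of "snd a"] by (auto simp: obstacle_def obst_indices_def strictly_convex_body_def)

lemma closed_obstacle: "a \<in> obst_indices N \<Longrightarrow> closed (obstacle Ob a)"
  unfolding obstacle_def using compact_base[of "snd a"]
  by (auto simp: obst_indices_def add.commute[of _ "int_vec _"] intro!: compact_imp_closed compact_translation)

text \<open>The projections of the base obstacles to a coordinate axis are compact, pairwise
  disjoint and contained in the open unit interval. There are finitely many of them, so one \<delta>
  bounds from below their distances from 0, from 1 and from each other.\<close>

lemma coord_separation:
  "\<exists>\<delta>>0. \<forall>a\<in>obst_indices N. \<forall>b\<in>obst_indices N. \<forall>x\<in>obstacle Ob a. \<forall>y\<in>obstacle Ob b. \<forall>i.
     \<bar>x $ i - y $ i\<bar> < \<delta> \<longrightarrow> snd a = snd b \<and> fst a $ i = fst b $ i"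
proof -
  let ?K = "\<lambda>i r. (\<lambda>x. x $ i) ` base_obstacle Ob r"
  let ?P = "\<lambda>d (i, r, s). \<forall>u\<in>?K i r. \<forall>v\<in>?K i s. d \<le> u \<and> d \<le> 1 - u \<and> d \<le> v \<and> d \<le> 1 - v \<and> (r \<noteq> s \<longrightarrow> d \<le> \<bar>u - v\<bar>)"
  have away: "\<exists>d>0. \<forall>u\<in>?K i r. d \<le> u \<and> d \<le> 1 - u" if "r \<in> {1..N}" for i :: 'm and r
  proof -
    have range: "0 < u \<and> u < 1" if "u \<in> ?K i r" for u
      using base_coord[OF \<open>r \<in> {1..N}\<close>] that by auto
    then have "?K i r \<inter> {0, 1} = {}" by force
    then obtain d where "d > 0" "\<forall>u\<in>?K i r. \<forall>v\<in>{0, 1}. d \<le> dist u v"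
      using separate_compact_closed[OF compact_base_proj[OF \<open>r \<in> {1..N}\<close>], of "{0, 1}" i] by auto
    then show ?thesis using range by (intro exI[of _ d]) (fastforce simp: dist_real_def)
  qed
  have "\<exists>d>0. \<forall>p\<in>UNIV \<times> {1..N} \<times> {1..N}. ?P d p"
  proof (rule finite_uniform_pos)
    fix p :: "'m \<times> nat \<times> nat" assume "p \<in> UNIV \<times> {1..N} \<times> {1..N}"
    then obtain i r s where p: "p = (i, r, s)" "r \<in> {1..N}" "s \<in> {1..N}" by auto
    obtain d e where de: "d > 0" "\<forall>u\<in>?K i r. d \<le> u \<and> d \<le> 1 - u" "e > 0" "\<forall>u\<in>?K i s. e \<le> u \<and> e \<le> 1 - u"
      using away p by meson
    have "\<exists>f>0. r \<noteq> s \<longrightarrow> (\<forall>u\<in>?K i r. \<forall>v\<in>?K i s. f \<le> dist u v)"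
    proof (cases "r = s")
      case False
      then show ?thesis
        using separate_compact_closed[OF compact_base_proj[OF p(2)] compact_imp_closed[OF compact_base_proj[OF p(3)]] proj_disjoint[OF p(2,3)]]
        by auto
    qed (auto intro: exI[of _ 1])
    then obtain f where f: "f > 0" "r \<noteq> s \<Longrightarrow> \<forall>u\<in>?K i r. \<forall>v\<in>?K i s. f \<le> \<bar>u - v\<bar>"
      by (auto simp: dist_real_def)
    have "?P (min d (min e f)) p"
      unfolding p(1) prod.case
    proof (intro ballI)
      fix u v assume uv: "u \<in> ?K i r" "v \<in> ?K i s"
      then have "d \<le> u \<and> d \<le> 1 - u" "e \<le> v \<and> e \<le> 1 - v" "r \<noteq> s \<longrightarrow> f \<le> \<bar>u - v\<bar>"
        using de f(2) by blast+
      then show "min d (min e f) \<le> u \<and> min d (min e f) \<le> 1 - u \<and> min d (min e f) \<le> v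
          \<and> min d (min e f) \<le> 1 - v \<and> (r \<noteq> s \<longrightarrow> min d (min e f) \<le> \<bar>u - v\<bar>)"
        by linarith
    qed
    then show "\<exists>d>0. ?P d p" using de f by (intro exI[of _ "min d (min e f)"]) auto
  next
    fix p d e assume "?P d p" "e \<le> d"
    then show "?P e p" unfolding case_prod_beta by (meson order_trans)
  qed simp
  then obtain d where d: "d > 0" "\<And>i r s. r \<in> {1..N} \<Longrightarrow> s \<in> {1..N} \<Longrightarrow> ?P d (i, r, s)" by force
  show ?thesis
  proof (intro exI[of _ d] conjI ballI allI impI d(1))
    fix a b x y i
    assume ab: "a \<in> obst_indices N" "b \<in> obst_indices N" and xy: "x \<in> obstacle Ob a" "y \<in> obstacle Ob b"
      and close: "\<bar>x $ i - y $ i\<bar> < d"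
    define u v where "u = x $ i - of_int (fst a $ i)" and "v = y $ i - of_int (fst b $ i)"
    have rs: "snd a \<in> {1..N}" "snd b \<in> {1..N}" using ab by (auto simp: obst_indices_def)
    have "u \<in> ?K i (snd a)" "v \<in> ?K i (snd b)"
      using xy by (auto simp: mem_obstacle_iff u_def v_def int_vec_def intro!: rev_image_eqI)
    then have uv: "d \<le> u" "d \<le> 1 - u" "d \<le> v" "d \<le> 1 - v" "snd a \<noteq> snd b \<longrightarrow> d \<le> \<bar>u - v\<bar>"
      using d(2)[OF rs, of i] by auto
    \<comment> \<open>Both \<open>u\<close> and \<open>v\<close> lie between \<open>d\<close> and
      \<open>1 - d\<close>, so they differ by at most \<open>1 - 2 * d\<close>. The integer parts
      then differ by less than 1, hence agree, and \<open>u - v\<close> becomes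
      \<open>x $ i - y $ i\<close>.\<close>
    have "\<bar>real_of_int (fst a $ i) - real_of_int (fst b $ i)\<bar> < 1"
      using uv(1-4) close unfolding u_def v_def by linarith
    then show "fst a $ i = fst b $ i" by linarith
    then show "snd a = snd b" using uv(5) close unfolding u_def v_def by auto
  qed
qed

text \<open>Up to translation there are only finitely many obstacles, and each has an interior
  point.\<close>

lemma inner_balls: "\<exists>\<rho>>0. \<rho> \<le> 1 \<and> (\<forall>a\<in>obst_indices N. \<exists>z. cball z \<rho> \<subseteq> obstacle Ob a)"
proof -
  have "\<exists>d>0. \<forall>r\<in>{1..N}. \<exists>z. cball z d \<subseteq> base_obstacle Ob r"
  proof (rule finite_uniform_pos)
    fix r assume "r \<in> {1..N}"
    then obtain z where "z \<in> interior (base_obstacle Ob r)"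
      using body[of r] unfolding strictly_convex_body_def by blast
    then show "\<exists>d>0. \<exists>z. cball z d \<subseteq> base_obstacle Ob r" by (auto simp: mem_interior_cball)
  qed (auto, meson order_trans subset_cball)
  then obtain d where d: "d > 0" "\<forall>r\<in>{1..N}. \<exists>z. cball z d \<subseteq> base_obstacle Ob r" by auto
  have "\<exists>z. cball z (min d 1) \<subseteq> obstacle Ob a" if a: "a \<in> obst_indices N" for a
  proof -
    obtain z where z: "cball z d \<subseteq> base_obstacle Ob (snd a)"
      using d a by (auto simp: obst_indices_def)
    have "cball (z + int_vec (fst a)) (min d 1) \<subseteq> obstacle Ob a"
    proof
      fix x assume "x \<in> cball (z + int_vec (fst a)) (min d 1)"
      then have "x - int_vec (fst a) \<in> cball z d" by (auto simp: dist_norm algebra_simps)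
      then show "x \<in> obstacle Ob a" using z by (auto simp: mem_obstacle_iff)
    qed
    then show ?thesis by blast
  qed
  then show ?thesis using d(1) by (intro exI[of _ "min d 1"]) auto
qed

section \<open>Flights almost parallel to a coordinate axis\<close>

text \<open>Here \<open>b\<close> is the translate of \<open>a\<close> by an integer multiple
  \<open>c\<close> of \<open>axis i 1\<close>. The assumption \<open>pos\<close> forces
  \<open>c\<close> to be at least 1, so \<open>x + axis i 1\<close> lies on the segment from
  \<open>x\<close> to its translate in \<open>b\<close>.\<close>

lemma short_flight_meets_shift:
  assumes a: "a \<in> obst_indices N" and b: "b \<in> obst_indices N" and "b \<noteq> a"
    and x: "x \<in> obstacle Ob a" and y: "y \<in> obstacle Ob b"
    and r: "snd a = snd b" and k: "\<And>j. j \<noteq> i \<Longrightarrow> fst a $ j = fst b $ j" and pos: "(y - x) $ i \<ge> 0"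
  shows "obstacle Ob (shift i a) \<inter> convex hull (obstacle Ob a \<union> obstacle Ob b) \<noteq> {}"
proof -
  define c where "c = fst b $ i - fst a $ i"
  have fst_b: "fst b = fst a + axis i c"
    using k by (auto simp: vec_eq_iff axis_def c_def)
  then have "c \<noteq> 0" using r \<open>b \<noteq> a\<close> by (auto simp: prod_eq_iff vec_eq_iff axis_def)
  have rN: "snd a \<in> {1..N}" using a by (auto simp: obst_indices_def)
  have "(y - int_vec (fst b)) $ i < 1"
    using base_coord(2)[OF rN, of "y - int_vec (fst b)"] y r by (simp add: mem_obstacle_iff)
  moreover have "0 < (x - int_vec (fst a)) $ i"
    using base_coord(1)[OF rN, of "x - int_vec (fst a)"] x by (simp add: mem_obstacle_iff)
  ultimately have "real_of_int c > -1" using pos by (simp add: c_def int_vec_def)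
  then have c1: "real_of_int c \<ge> 1" using \<open>c \<noteq> 0\<close> by linarith
  let ?C = "convex hull (obstacle Ob a \<union> obstacle Ob b)"
  have "x + axis i (of_int c) \<in> obstacle Ob b"
    using x r by (simp add: mem_obstacle_iff fst_b int_vec_add int_vec_axis)
  then have "x \<in> ?C" "x + axis i (of_int c) \<in> ?C" using x by (auto intro: hull_inc)
  then have "(1 - 1 / of_int c) *\<^sub>R x + (1 / of_int c) *\<^sub>R (x + axis i (of_int c)) \<in> ?C"
    using c1 by (intro convexD[OF convex_convex_hull]) auto
  also have "(1 - 1 / of_int c) *\<^sub>R x + (1 / of_int c) *\<^sub>R (x + axis i (of_int c)) = x + axis i 1"
    using c1 by (auto simp: vec_eq_iff axis_def field_simps)
  finally have "x + axis i 1 \<in> ?C" .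
  moreover have "x + axis i 1 \<in> obstacle Ob (shift i a)" using x by (simp add: mem_obstacle_shift)
  ultimately show ?thesis by blast
qed

text \<open>In both the short and the long case the hull of the two obstacles meets
  \<open>shift i a\<close>. Since that obstacle differs from \<open>a\<close> and nothing is between
  \<open>a\<close> and \<open>b\<close>, it must be \<open>b\<close>.\<close>

lemma flight_along_axis:
  "\<exists>\<epsilon>>0. \<forall>a\<in>obst_indices N. \<forall>b\<in>obst_indices N. \<forall>x\<in>obstacle Ob a. \<forall>y\<in>obstacle Ob b.
     b \<noteq> a \<longrightarrow> \<not> (\<exists>c\<in>obst_indices N. between Ob c a b) \<longrightarrow>
     norm (y - x) - (y - x) $ i \<le> \<epsilon> * norm (y - x) \<longrightarrow> b = shift i a"
proof -
  obtain \<delta> where \<delta>: "\<delta> > 0" and sep: "\<And>a b x y j. \<lbrakk>a \<in> obst_indices N; b \<in> obst_indices N;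
      x \<in> obstacle Ob a; y \<in> obstacle Ob b; \<bar>x $ j - y $ j\<bar> < \<delta>\<rbrakk> \<Longrightarrow> snd a = snd b \<and> fst a $ j = fst b $ j"
    using coord_separation by meson
  obtain \<rho> where \<rho>: "\<rho> > 0" "\<rho> \<le> 1" and ball: "\<And>a. a \<in> obst_indices N \<Longrightarrow> \<exists>z. cball z \<rho> \<subseteq> obstacle Ob a"
    using inner_balls by meson
  \<comment> \<open>\<open>M\<close> separates short flights from long ones. On a short flight a
    coordinate other than \<open>i\<close> changes by at most
    \<open>\<kappa> * M < \<delta>\<close>. On a long one the distance to the centre of an inner
    ball will be at most \<open>\<kappa> + 1 / M\<close>, where each summand is at most
    \<open>\<rho> / 2\<close>.\<close>
  define M where "M = 2 / \<rho>"
  define \<kappa> where "\<kappa> = min (\<rho> / 2) (\<delta> / (2 * M))"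
  have M: "M \<ge> 2" using \<rho> by (simp add: M_def field_simps)
  have \<kappa>: "\<kappa> > 0" "\<kappa> \<le> \<rho> / 2" "\<kappa> * M < \<delta>" "\<kappa> \<le> 1"
  proof -
    show "\<kappa> > 0" using \<rho> \<delta> M by (simp add: \<kappa>_def)
    show "\<kappa> \<le> \<rho> / 2" by (simp add: \<kappa>_def)
    show "\<kappa> \<le> 1" using \<rho> by (simp add: \<kappa>_def)
    have "\<kappa> * M \<le> \<delta> / (2 * M) * M" using M by (intro mult_right_mono) (auto simp: \<kappa>_def)
    then show "\<kappa> * M < \<delta>" using M \<delta> by simp
  qed
  have "b = shift i a"
    if a: "a \<in> obst_indices N" and b: "b \<in> obst_indices N" and x: "x \<in> obstacle Ob a" and y: "y \<in> obstacle Ob b"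
      and neq: "b \<noteq> a" and nb: "\<not> (\<exists>c\<in>obst_indices N. between Ob c a b)"
      and good: "norm (y - x) - (y - x) $ i \<le> \<kappa>\<^sup>2 / 2 * norm (y - x)" for a b x y
  proof -
    define w where "w = y - x"
    define L where "L = norm w"
    define u where "u = w - L *\<^sub>R axis i 1"
    have L0: "L \<ge> 0" by (simp add: L_def)
    have good': "L - w $ i \<le> \<kappa>\<^sup>2 / 2 * L" using good by (simp add: w_def L_def)
    \<comment> \<open>The threshold \<open>\<kappa>\<^sup>2 / 2\<close> makes the right-hand side of
      \<open>norm_diff_axis\<close> at most the square of \<open>\<kappa> * L\<close>.\<close>
    have "(norm u)\<^sup>2 \<le> 2 * L * (\<kappa>\<^sup>2 / 2 * L)"
      unfolding u_def L_def norm_diff_axis using good' by (intro mult_left_mono) (auto simp: L_def)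
    also have "\<dots> = (\<kappa> * L)\<^sup>2" by (simp add: power2_eq_square)
    finally have u: "norm u \<le> \<kappa> * L" using \<kappa> L0 by (simp add: power2_le_iff_abs_le)
    have "obstacle Ob (shift i a) \<inter> convex hull (obstacle Ob a \<union> obstacle Ob b) \<noteq> {}"
    proof (cases "L \<le> M")
      case True
      have small: "\<bar>x $ j - y $ j\<bar> < \<delta>" if "j \<noteq> i" for j
      proof -
        have "\<bar>x $ j - y $ j\<bar> = \<bar>u $ j\<bar>" using that by (simp add: u_def w_def axis_def)
        also have "\<dots> \<le> \<kappa> * L" using component_le_norm_cart[of u j] u by linarith
        also have "\<dots> \<le> \<kappa> * M" using True \<kappa> by simp
        finally show ?thesis using \<kappa> by simp
      qed
      have "snd a = snd b"
      proof -
        obtain j where "j \<noteq> i" using other_coord by blast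
        then show ?thesis using sep[OF a b x y small] by blast
      qed
      moreover have "w $ i \<ge> 0"
      proof -
        have "\<kappa>\<^sup>2 \<le> 1" using \<kappa> by (simp add: power_le_one)
        then have "\<kappa>\<^sup>2 / 2 * L \<le> 1 * L" using L0 by (intro mult_right_mono) auto
        then show ?thesis using good' by simp
      qed
      ultimately show ?thesis
        using short_flight_meets_shift[OF a b neq x y] sep[OF a b x y small] by (auto simp: w_def)
    next
      case False
      obtain z where z: "cball z \<rho> \<subseteq> obstacle Ob a" using ball a by blast
      then have za: "z \<in> obstacle Ob a" using \<rho> by (auto simp: subset_iff)
      let ?C = "convex hull (obstacle Ob a \<union> obstacle Ob b)"
      \<comment> \<open>The segment runs from the centre \<open>z\<close> of the ball, not from
        \<open>x\<close>. At parameter \<open>1 / L\<close> it has advanced by roughly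
        \<open>axis i 1\<close>, so \<open>p\<close> falls into the translated ball.\<close>
      define p where "p = (1 - 1 / L) *\<^sub>R z + (1 / L) *\<^sub>R y"
      have "p \<in> ?C"
        unfolding p_def using za y False M
        by (intro convexD[OF convex_convex_hull]) (auto intro: hull_inc)
      moreover have "p \<in> obstacle Ob (shift i a)"
      proof -
        \<comment> \<open>Split \<open>y - z\<close> as \<open>w + (x - z)\<close>. The first part
          contributes the deviation \<open>u\<close>, the second is bounded by the diameter of the
          obstacle, and both are divided by \<open>L\<close>.\<close>
        have "p - axis i 1 - z = (1 / L) *\<^sub>R u + (1 / L) *\<^sub>R (x - z)"
          using False M by (simp add: p_def u_def w_def vec_eq_iff field_simps)
        then have "norm (p - axis i 1 - z) \<le> norm ((1 / L) *\<^sub>R u) + norm ((1 / L) *\<^sub>R (x - z))"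
          by (metis norm_triangle_ineq)
        also have "\<dots> = norm u / L + norm (x - z) / L" using False M by simp
        also have "\<dots> \<le> \<kappa> + 1 / L"
          using u norm_diff_obstacle[OF a x za] False M by (intro add_mono) (auto simp: field_simps)
        also have "1 / L \<le> 1 / M" using False M by (simp add: field_simps)
        also have "\<kappa> + 1 / M \<le> \<rho>" using \<kappa> by (simp add: M_def)
        finally have "p - axis i 1 \<in> cball z \<rho>" by (simp add: dist_norm norm_minus_commute)
        then show ?thesis using z by (auto simp: mem_obstacle_shift)
      qed
      ultimately show ?thesis by blast
    qed
    then show ?thesis
      using nb shift_in_obst_indices[OF a, of i] shift_neq(1)[of i a] unfolding between_def by blast
  qed
  then show ?thesis using \<kappa> by (intro exI[of _ "\<kappa>\<^sup>2 / 2"]) auto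
qed

section \<open>Loss of displacement along admissible pieces\<close>

text \<open>A flight \<open>j\<close> is good if its loss \<open>l j\<close> is at most
  \<open>\<epsilon> * L j\<close>. Good flights have length at most 2 and are never consecutive, so
  the loss on a bad neighbour pays for them. The term \<open>2 * c\<close> covers a good flight
  without such a partner.\<close>

lemma axis_loss:
  "\<exists>c>0. \<forall>xs as. admissible N Ob as \<longrightarrow> piece_of_type N Ob xs as \<longrightarrow>
     c * piece_length xs - 2 * c \<le> piece_length xs - displacement xs $ i"
proof -
  obtain \<epsilon> where \<epsilon>: "\<epsilon> > 0" and along: "\<And>a b x y. \<lbrakk>a \<in> obst_indices N; b \<in> obst_indices N;
      x \<in> obstacle Ob a; y \<in> obstacle Ob b; b \<noteq> a; \<not> (\<exists>c\<in>obst_indices N. between Ob c a b);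
      norm (y - x) - (y - x) $ i \<le> \<epsilon> * norm (y - x)\<rbrakk> \<Longrightarrow> b = shift i a"
    using flight_along_axis[of i] by meson
  obtain \<delta> where \<delta>: "\<delta> > 0" and sep: "\<And>a b x y j. \<lbrakk>a \<in> obst_indices N; b \<in> obst_indices N;
      x \<in> obstacle Ob a; y \<in> obstacle Ob b; \<bar>x $ j - y $ j\<bar> < \<delta>\<rbrakk> \<Longrightarrow> snd a = snd b \<and> fst a $ j = fst b $ j"
    using coord_separation by meson
  \<comment> \<open>Half of the loss \<open>\<epsilon> * L j\<close> of a bad flight covers
    \<open>c * L j\<close>. The other half is at least \<open>\<epsilon> * \<delta> / 2\<close>,
    hence at least \<open>2 * c\<close>, which pays for an adjacent good flight.\<close>
  define c where "c = min (\<epsilon> / 2) (\<epsilon> * \<delta> / 4)"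
  have c: "c > 0" "2 * c \<le> \<epsilon>" "4 * c \<le> \<epsilon> * \<delta>" using \<epsilon> \<delta> by (auto simp: c_def)
  have "c * piece_length xs - 2 * c \<le> piece_length xs - displacement xs $ i"
    if adm: "admissible N Ob as" and type: "piece_of_type N Ob xs as" for xs as
  proof -
    define n where "n = length xs - 1"
    define L where "L j = norm (xs ! Suc j - xs ! j)" for j
    define l where "l j = L j - (xs ! Suc j - xs ! j) $ i" for j
    have len: "length as = Suc n" "length xs = Suc n"
      using type by (auto simp: piece_of_type_def trajectory_piece_def n_def)
    have idx: "as ! j \<in> obst_indices N" if "j \<le> n" for j
      using type len that by (auto simp: piece_of_type_def)
    have on: "xs ! j \<in> obstacle Ob (as ! j)" if "j \<le> n" for j
      using type len that closed_obstacle[OF idx[OF that]]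
      by (auto simp: piece_of_type_def intro: frontier_subset_closed[THEN subsetD])
    have neq: "as ! Suc j \<noteq> as ! j" and nb: "\<not> (\<exists>c\<in>obst_indices N. between Ob c (as ! j) (as ! Suc j))"
      if "j < n" for j
      using adm len that unfolding admissible_def by auto
    have l0: "l j \<ge> 0" for j
      unfolding l_def L_def using component_le_norm_cart[of "xs ! Suc j - xs ! j" i] by linarith
    \<comment> \<open>In a shorter flight every coordinate would change by less than \<delta>, and
      by \<open>sep\<close> the two indices would coincide.\<close>
    have L\<delta>: "\<delta> \<le> L j" if "j < n" for j
    proof (rule ccontr)
      assume "\<not> \<delta> \<le> L j"
      then have "\<bar>xs ! Suc j $ q - xs ! j $ q\<bar> < \<delta>" for q
        using component_le_norm_cart[of "xs ! Suc j - xs ! j" q] by (simp add: L_def)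
      then have "snd (as ! Suc j) = snd (as ! j) \<and> fst (as ! Suc j) $ q = fst (as ! j) $ q" for q
        using that sep[OF idx idx on on, of "Suc j" j q] by auto
      then show False using neq[OF that] by (simp add: prod_eq_iff vec_eq_iff)
    qed
    have good_shift: "as ! Suc j = shift i (as ! j)" if "j < n" "l j \<le> \<epsilon> * L j" for j
      using that idx on neq nb by (intro along[of _ _ "xs ! j" "xs ! Suc j"]) (auto simp: l_def L_def)
    \<comment> \<open>Translated back by the unit vector \<open>axis i 1\<close>, the endpoint lies
      in the same obstacle as the starting point, so the length is at most 1 + 1.\<close>
    have good_short: "L j \<le> 2" if "j < n" "l j \<le> \<epsilon> * L j" for j
    proof -
      have "xs ! Suc j - axis i 1 \<in> obstacle Ob (as ! j)"
        using on[of "Suc j"] good_shift that by (simp add: mem_obstacle_shift)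
      then have "norm (xs ! Suc j - axis i 1 - xs ! j) \<le> 1"
        using that idx on by (intro norm_diff_obstacle[of "as ! j"]) auto
      then show ?thesis
        using norm_triangle_ineq[of "xs ! Suc j - axis i 1 - xs ! j" "axis i 1"]
        by (simp add: L_def algebra_simps)
    qed
    have not_both: "\<epsilon> * L j < l j \<or> \<epsilon> * L (Suc j) < l (Suc j)" if "Suc j < n" for j
    proof (rule ccontr)
      assume "\<not> ?thesis"
      then have "as ! Suc j = shift i (as ! j)" "as ! Suc (Suc j) = shift i (shift i (as ! j))"
        using good_shift[of j] good_shift[of "Suc j"] that by auto
      then have "between Ob (as ! Suc j) (as ! j) (as ! Suc (Suc j))"
        using between_shift_shift[OF obstacle_nonempty[OF idx[of j]]] that by simp
      then show False using adm len that unfolding admissible_def by auto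
    qed
    have bad: "c * L j + 2 * c \<le> l j" if "j < n" "\<epsilon> * L j < l j" for j
    proof -
      have "2 * c * L j \<le> \<epsilon> * L j" using c by (intro mult_right_mono) (auto simp: L_def)
      moreover have "\<epsilon> * \<delta> \<le> \<epsilon> * L j" using \<epsilon> L\<delta>[OF that(1)] by simp
      ultimately show ?thesis using that c by linarith
    qed
    have good: "c * L j \<le> 2 * c" if "j < n" "\<not> \<epsilon> * L j < l j" for j
      using good_short[of j] that c(1) by simp
    have "c * sum L {..<n} - 2 * c \<le> sum l {..<n}"
    proof (rule sum_pairwise_bound)
      show "c * L j - 2 * c \<le> l j" if "j < n" for j
        using bad[OF that] good[OF that] l0[of j] c(1) by linarith
      show "c * (L j + L (Suc j)) \<le> l j + l (Suc j)" if "Suc j < n" for j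
        using not_both[OF that] bad[of j] bad[of "Suc j"] good[of j] good[of "Suc j"] that
          l0[of j] l0[of "Suc j"] c(1)
        unfolding distrib_left by linarith
    qed (use c in simp)
    moreover have "piece_length xs = sum L {..<n}"
      by (simp add: piece_length_def n_def L_def dist_norm norm_minus_commute)
    moreover have "displacement xs $ i = (\<Sum>j<n. (xs ! Suc j - xs ! j) $ i)"
    proof -
      have "displacement xs = xs ! n - xs ! 0"
        using len by (cases xs) (auto simp: displacement_def last_conv_nth)
      also have "\<dots> = (\<Sum>j<n. xs ! Suc j - xs ! j)"
        by (rule sum_lessThan_telescope[symmetric])
      finally show ?thesis by simp
    qed
    ultimately show ?thesis by (simp add: l_def sum_subtractf)
  qed
  then show ?thesis using c(1) by blast
qed

section \<open>A coordinate vector separates the two rotation sets\<close>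

lemma axis_notin_admissible_rotation_set: "axis i 1 \<notin> admissible_rotation_set N Ob"
proof
  assume "axis i 1 \<in> admissible_rotation_set N Ob"
  then obtain T s where T: "\<And>n. \<exists>as. admissible N Ob as \<and> piece_of_type N Ob (T n) as"
    and lim: "filterlim (\<lambda>n. piece_length (T n)) at_top sequentially" and s: "strict_mono s"
    and conv: "((\<lambda>n. displacement (T n) /\<^sub>R piece_length (T n)) \<circ> s) \<longlonglongrightarrow> axis i 1"
    unfolding admissible_rotation_set_def limit_point_of_seq_def by auto
  obtain c where c: "c > 0" "\<And>n. c * piece_length (T n) - 2 * c \<le> piece_length (T n) - displacement (T n) $ i"
    using axis_loss[of i] T by meson
  define P where "P n = piece_length (T (s n))" for n
  have P: "filterlim P at_top sequentially"
    unfolding P_def using filterlim_compose[OF lim filterlim_subseq[OF s]] .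
  have "(\<lambda>n. (displacement (T (s n)) /\<^sub>R P n) $ i) \<longlonglongrightarrow> axis i 1 $ i"
    using conv by (intro tendsto_vec_nth) (simp add: o_def P_def)
  then have "(\<lambda>n. displacement (T (s n)) $ i / P n) \<longlonglongrightarrow> 1"
    by (simp add: divide_inverse mult.commute)
  moreover have "(\<lambda>n. 1 - c + 2 * c / P n) \<longlonglongrightarrow> 1 - c + 0"
    by (intro tendsto_intros real_tendsto_divide_at_top[OF tendsto_const P])
  \<comment> \<open>Divide the bound of \<open>axis_loss\<close> by \<open>P n\<close>, which is
    eventually positive.\<close>
  moreover have "eventually (\<lambda>n. displacement (T (s n)) $ i / P n \<le> 1 - c + 2 * c / P n) sequentially"
    using filterlim_at_top_dense[THEN iffD1, OF P, rule_format, of 0]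
  proof eventually_elim
    case (elim n)
    then show ?case using c(2)[of "s n"] by (simp add: P_def field_simps)
  qed
  ultimately have "1 \<le> 1 - c + 0"
    by (intro tendsto_le[of sequentially]) auto
  then show False using c(1) by simp
qed

text \<open>A coordinate \<open>j\<close> other than \<open>i\<close> vanishes on the axis, whereas
  on an obstacle it lies strictly between two consecutive integers.\<close>

lemma axis_in_billiard_table: "t *\<^sub>R axis i 1 \<in> billiard_table N Ob"
proof -
  have "t *\<^sub>R axis i 1 \<notin> obstacle Ob a" if a: "a \<in> obst_indices N" for a
  proof
    assume mem: "t *\<^sub>R axis i 1 \<in> obstacle Ob a"
    obtain j where "j \<noteq> i" using other_coord by blast
    have r: "snd a \<in> {1..N}" using a by (auto simp: obst_indices_def)
    have "0 < - real_of_int (fst a $ j)" "- real_of_int (fst a $ j) < 1"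
      using base_coord[OF r, of "t *\<^sub>R axis i 1 - int_vec (fst a)" j] mem \<open>j \<noteq> i\<close>
      by (auto simp: mem_obstacle_iff int_vec_def axis_def)
    then have "0 < - (fst a $ j)" "- (fst a $ j) < 1" by linarith+
    then show False by linarith
  qed
  then show ?thesis unfolding billiard_table_def by (intro closure_subset[THEN subsetD]) auto
qed

lemma axis_in_rotation_set: "axis i 1 \<in> rotation_set N Ob"
proof -
  \<comment> \<open>A two-point list has no reflection to check. \<open>Suc n\<close> keeps the
    endpoints distinct at \<open>n = 0\<close>, and every quotient of displacement by length is
    exactly \<open>axis i 1\<close>.\<close>
  define T :: "nat \<Rightarrow> (real ^ 'm) list" where "T n = [0, real (Suc n) *\<^sub>R axis i 1]" for n
  have "trajectory_piece N Ob (T n)" for n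
  proof -
    have "closed_segment 0 (real (Suc n) *\<^sub>R axis i 1) \<subseteq> billiard_table N Ob"
      using axis_in_billiard_table by (auto simp: closed_segment_def)
    moreover from this have "0 \<in> billiard_table N Ob" "real (Suc n) *\<^sub>R axis i 1 \<in> billiard_table N Ob"
      by auto
    moreover have "0 \<noteq> real (Suc n) *\<^sub>R (axis i 1 :: real ^ 'm)"
      by (simp add: axis_eq_0_iff del: of_nat_Suc)
    ultimately show ?thesis unfolding trajectory_piece_def T_def by (simp del: of_nat_Suc)
  qed
  moreover have len: "piece_length (T n) = real (Suc n)" for n
    by (simp add: piece_length_def T_def del: of_nat_Suc)
  moreover have "filterlim (\<lambda>n. piece_length (T n)) at_top sequentially"
    unfolding len by (rule filterlim_compose[OF filterlim_real_sequentially filterlim_Suc])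
  moreover have "limit_point_of_seq (\<lambda>n. displacement (T n) /\<^sub>R piece_length (T n)) (axis i 1)"
    unfolding limit_point_of_seq_def len
    by (intro exI[of _ id]) (simp add: strict_mono_id displacement_def T_def o_def del: of_nat_Suc)
  ultimately show ?thesis unfolding rotation_set_def by blast
qed

end

lemma admissible_rotation_set_subset: "admissible_rotation_set N Ob \<subseteq> rotation_set N Ob"
  unfolding admissible_rotation_set_def rotation_set_def piece_of_type_def by blast

theorem theorem4p3:
  fixes N :: nat and Ob :: "nat \<Rightarrow> (real ^ 'm::finite) set set"
  assumes "CARD('m) \<ge> 2" and "N \<ge> 1"
    and "\<And>r. r \<in> {1..N} \<Longrightarrow> Ob r \<subseteq> torus"
    and "\<And>r s. r \<in> {1..N} \<Longrightarrow> s \<in> {1..N} \<Longrightarrow> r \<noteq> s \<Longrightarrow> Ob r \<inter> Ob s = {}"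
    and "\<And>r. r \<in> {1..N} \<Longrightarrow> base_obstacle Ob r \<subseteq> interior (cbox 0 1)"
    and "\<And>r. r \<in> {1..N} \<Longrightarrow> strictly_convex_body (base_obstacle Ob r)"
    and "\<And>r. r \<in> {1..N} \<Longrightarrow> C2_boundary (base_obstacle Ob r)"
    and "\<And>r. r \<in> {1..N} \<Longrightarrow> diameter (base_obstacle Ob r) < sqrt 2 / 4"
    and "\<And>i r s. r \<in> {1..N} \<Longrightarrow> s \<in> {1..N} \<Longrightarrow> r \<noteq> s \<Longrightarrow>
           (\<lambda>x. x $ i) ` base_obstacle Ob r \<inter> (\<lambda>x. x $ i) ` base_obstacle Ob s = {}"
    and "\<And>r s t. r \<in> {1..N} \<Longrightarrow> s \<in> {1..N} \<Longrightarrow> t \<in> {1..N} \<Longrightarrow>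
           r \<noteq> s \<Longrightarrow> r \<noteq> t \<Longrightarrow> s \<noteq> t \<Longrightarrow>
           convex hull (base_obstacle Ob r \<union> base_obstacle Ob s) \<inter> base_obstacle Ob t = {}"
  shows "admissible_rotation_set N Ob \<subset> rotation_set N Ob"
proof -
  interpret obstacle_family N Ob
  proof unfold_locales
    \<comment> \<open>By monotonicity of the square root, \<open>sqrt 2\<close> is at most
      \<open>sqrt 4 = 2\<close>, so the diameter is below 1/2.\<close>
    show "diameter (base_obstacle Ob r) \<le> 1" if "r \<in> {1..N}" for r
      using assms(8)[OF that] real_sqrt_le_mono[of 2 4] by simp
  qed (fact assms)+
  show ?thesis
    using admissible_rotation_set_subset axis_in_rotation_set axis_notin_admissible_rotation_set by blast
qed

end
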